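(* Every 2-local derivation on the Block-type Lie algebra $\mathcal{B}$ is a derivation.
   Context: $\mathbb{Z}_{+}$ denotes the set of nonnegative integers; all vector spaces and algebras are over $\mathbb{C}$. The Block-type Lie algebra $\mathcal{B}$ is the complex Lie algebra with basis $\{L_{\alpha,i}\mid \alpha\in\mathbb{Z}, i\in\mathbb{Z}_{+}\}$ and bracket $[L_{\alpha,i},L_{\beta,j}]=((\alpha-1)(j+1)-(\beta-1)(i+1))L_{\alpha+\beta,i+j}$ for $\alpha,\beta\in\mathbb{Z}$, $i,j\in\mathbb{Z}_{+}$. A derivation of a Lie algebra $\mathcal{L}$ is a linear map $D:\mathcal{L}\to\mathcal{L}$ with $D([x,y])=[D(x),y]+[x,D(y)]$ for all $x,y\in\mathcal{L}$. A 2-local derivation on $\mathcal{L}$ is a map $\Delta:\mathcal{L}\to\mathcal{L}$ (not necessarily linear) such that for any $x,y\in\mathcal{L}$ there exists a derivation $D_{x,y}$ of $\mathcal{L}$ (depending on $x,y$) with $\Delta(x)=D_{x,y}(x)$ and $\Delta(y)=D_{x,y}(y)$. *)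

theory Defs
  imports Complex_Main "HOL-Library.Poly_Mapping"
begin

locale lie_algebra = vector_space scale
  for scale :: "'k::field \<Rightarrow> 'a::ab_group_add \<Rightarrow> 'a" +
  fixes bracket :: "'a \<Rightarrow> 'a \<Rightarrow> 'a"
  assumes bracket_add_left: "bracket (x + y) z = bracket x z + bracket y z"
    and bracket_add_right: "bracket x (y + z) = bracket x y + bracket x z"
    and bracket_scale_left: "bracket (scale c x) y = scale c (bracket x y)"
    and bracket_scale_right: "bracket x (scale c y) = scale c (bracket x y)"
    and bracket_self: "bracket x x = 0"
    and jacobi: "bracket x (bracket y z) + bracket y (bracket z x) + bracket z (bracket x y) = 0"
begin

definition derivation :: "('a \<Rightarrow> 'a) \<Rightarrow> bool" where
  "derivation D \<longleftrightarrow>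
     Vector_Spaces.linear scale scale D \<and>
     (\<forall>x y. D (bracket x y) = bracket (D x) y + bracket x (D y))"

definition two_local_derivation :: "('a \<Rightarrow> 'a) \<Rightarrow> bool" where
  "two_local_derivation \<Delta> \<longleftrightarrow> (\<forall>x y. \<exists>D. derivation D \<and> \<Delta> x = D x \<and> \<Delta> y = D y)"

end

text \<open>The Block-type Lie algebra is realised on the finitely supported functions from
  \<open>int \<times> nat\<close> to the complex numbers; the value at \<open>(\<alpha>, i)\<close> is the coordinate with
  respect to the basis vector \<open>L\<^bsub>\<alpha>,i\<^esub>\<close>.\<close>

type_synonym block = "(int \<times> nat) \<Rightarrow>\<^sub>0 complex"

definition block_L :: "int \<Rightarrow> nat \<Rightarrow> block" where
  "block_L \<alpha> i = Poly_Mapping.single (\<alpha>, i) 1"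

definition block_scale :: "complex \<Rightarrow> block \<Rightarrow> block" where
  "block_scale c x = Poly_Mapping.map (\<lambda>a. c * a) x"

text \<open>Bilinear extension of the bracket of basis vectors, see \<open>block_bracket_L\<close> below.\<close>

definition block_bracket :: "block \<Rightarrow> block \<Rightarrow> block" where
  "block_bracket x y =
     (\<Sum>(\<alpha>, i)\<in>Poly_Mapping.keys x. \<Sum>(\<beta>, j)\<in>Poly_Mapping.keys y.
        block_scale
          (Poly_Mapping.lookup x (\<alpha>, i) * Poly_Mapping.lookup y (\<beta>, j) *
             of_int ((\<alpha> - 1) * (int j + 1) - (\<beta> - 1) * (int i + 1)))
          (block_L (\<alpha> + \<beta>) (i + j)))"

lemma lookup_block_scale [simp]:
  "Poly_Mapping.lookup (block_scale c x) k = c * Poly_Mapping.lookup x k"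
  by (simp add: block_scale_def map.rep_eq when_def)

lemma block_scale_L: "block_scale c (block_L \<alpha> i) = Poly_Mapping.single (\<alpha>, i) c"
  by (rule poly_mapping_eqI) (simp add: block_L_def lookup_single when_def)

interpretation block: vector_space block_scale
  by unfold_locales (auto intro!: poly_mapping_eqI simp: lookup_add algebra_simps)

lemma block_expansion:
  "x = (\<Sum>(\<alpha>, i)\<in>Poly_Mapping.keys x.
          block_scale (Poly_Mapping.lookup x (\<alpha>, i)) (block_L \<alpha> i))"
proof (rule poly_mapping_eqI)
  fix k
  have "(\<Sum>p\<in>Poly_Mapping.keys x. Poly_Mapping.lookup x p when p = k) = Poly_Mapping.lookup x k"
    by (cases "k \<in> Poly_Mapping.keys x")
       (auto simp: when_def sum.delta in_keys_iff intro: sum.neutral)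
  then show "Poly_Mapping.lookup x k = Poly_Mapping.lookup (\<Sum>(\<alpha>, i)\<in>Poly_Mapping.keys x.
          block_scale (Poly_Mapping.lookup x (\<alpha>, i)) (block_L \<alpha> i)) k"
    by (simp add: block_scale_L lookup_sum case_prod_unfold lookup_single)
qed

lemma block_basis:
  "inj (case_prod block_L)"
  "block.independent (range (case_prod block_L))"
  "block.span (range (case_prod block_L)) = UNIV"
proof -
  show inj: "inj (case_prod block_L)"
  proof (rule injI)
    fix p q assume "case_prod block_L p = case_prod block_L q"
    then have "Poly_Mapping.lookup (case_prod block_L p) q
        = Poly_Mapping.lookup (case_prod block_L q) q" by simp
    then show "p = q"
      by (auto simp: block_L_def lookup_single when_def case_prod_unfold split: if_splits)
  qed
  show "block.independent (range (case_prod block_L))"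
    unfolding block.independent_explicit_module
  proof (intro allI impI)
    fix t u v
    assume t: "finite t" "t \<subseteq> range (case_prod block_L)"
      and 0: "(\<Sum>v\<in>t. block_scale (u v) v) = 0" and v: "v \<in> t"
    from t v obtain p where p: "v = case_prod block_L p" by auto
    have "Poly_Mapping.lookup w p = (if w = v then 1 else 0)" if "w \<in> t" for w
    proof -
      from t that obtain q where q: "w = case_prod block_L q" by auto
      have "w = v \<longleftrightarrow> q = p"
        unfolding p q using inj by (rule inj_eq)
      then show ?thesis
        by (simp add: q block_L_def lookup_single when_def case_prod_unfold)
    qed
    then have "(\<Sum>w\<in>t. u w * Poly_Mapping.lookup w p) = (\<Sum>w\<in>t. if w = v then u w else 0)"
      by (intro sum.cong) auto
    also have "\<dots> = u v"
      using t v by (simp add: sum.delta)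
    finally show "u v = 0"
      using arg_cong[OF 0, of "\<lambda>z. Poly_Mapping.lookup z p"] by (simp add: lookup_sum)
  qed
  show "block.span (range (case_prod block_L)) = UNIV"
  proof -
    have "x \<in> block.span (range (case_prod block_L))" for x
    proof -
      have "block_L \<alpha> i \<in> block.span (range (case_prod block_L))" for \<alpha> i
        by (rule block.span_base) (metis case_prod_conv rangeI)
      then show ?thesis
        by (subst block_expansion, intro block.span_sum) (auto intro: block.span_scale)
    qed
    then show ?thesis by auto
  qed
qed

lemma block_bracket_superset:
  assumes "finite S" "finite T" "Poly_Mapping.keys x \<subseteq> S" "Poly_Mapping.keys y \<subseteq> T"
  shows "block_bracket x y =
     (\<Sum>(\<alpha>, i)\<in>S. \<Sum>(\<beta>, j)\<in>T.
        block_scale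
          (Poly_Mapping.lookup x (\<alpha>, i) * Poly_Mapping.lookup y (\<beta>, j) *
             of_int ((\<alpha> - 1) * (int j + 1) - (\<beta> - 1) * (int i + 1)))
          (block_L (\<alpha> + \<beta>) (i + j)))"
  unfolding block_bracket_def
  by (intro sum.mono_neutral_cong_left assms)
     (auto simp: in_keys_iff intro!: sum.neutral sum.mono_neutral_left assms(2,4))

lemma block_bracket_single:
  "block_bracket (Poly_Mapping.single (\<alpha>, i) a) (Poly_Mapping.single (\<beta>, j) b) =
     Poly_Mapping.single (\<alpha> + \<beta>, i + j)
       (a * b * of_int ((\<alpha> - 1) * (int j + 1) - (\<beta> - 1) * (int i + 1)))"
  by (subst block_bracket_superset[of "{(\<alpha>, i)}" "{(\<beta>, j)}"]) (auto simp: block_scale_L)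

lemma block_bracket_L:
  "block_bracket (block_L \<alpha> i) (block_L \<beta> j) =
     block_scale (of_int ((\<alpha> - 1) * (int j + 1) - (\<beta> - 1) * (int i + 1)))
       (block_L (\<alpha> + \<beta>) (i + j))"
  unfolding block_scale_L by (simp add: block_L_def block_bracket_single)

lemma block_bracket_add_left:
  "block_bracket (x + y) z = block_bracket x z + block_bracket y z"
proof -
  let ?S = "Poly_Mapping.keys x \<union> Poly_Mapping.keys y" and ?T = "Poly_Mapping.keys z"
  have "Poly_Mapping.keys (x + y) \<subseteq> ?S" by (rule keys_add)
  then show ?thesis
    by (simp add: block_bracket_superset[of ?S ?T] lookup_add sum.distrib[symmetric]
        case_prod_unfold block.scale_left_distrib[symmetric] distrib_right)
qed

lemma block_bracket_anticommute: "block_bracket x y = - block_bracket y x"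
proof -
  let ?f = "\<lambda>x y p q. block_scale
      (Poly_Mapping.lookup x p * Poly_Mapping.lookup y q *
         of_int ((fst p - 1) * (int (snd q) + 1) - (fst q - 1) * (int (snd p) + 1)))
      (block_L (fst p + fst q) (snd p + snd q))"
  have br: "block_bracket x y = (\<Sum>p\<in>Poly_Mapping.keys x. \<Sum>q\<in>Poly_Mapping.keys y. ?f x y p q)" for x y
    by (simp add: block_bracket_def case_prod_unfold)
  have "?f x y p q = - ?f y x q p" for p q
    by (rule poly_mapping_eqI) (simp add: algebra_simps)
  then have "block_bracket x y
      = - (\<Sum>p\<in>Poly_Mapping.keys x. \<Sum>q\<in>Poly_Mapping.keys y. ?f y x q p)"
    unfolding br by (simp only: sum_negf)
  also have "\<dots> = - block_bracket y x"
    unfolding br by (subst sum.swap) (rule refl)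
  finally show ?thesis .
qed

lemma block_bracket_add_right:
  "block_bracket x (y + z) = block_bracket x y + block_bracket x z"
  using block_bracket_anticommute[of x] by (simp add: block_bracket_add_left)

lemma block_bracket_scale_left: "block_bracket (block_scale c x) y = block_scale c (block_bracket x y)"
proof -
  have "Poly_Mapping.keys (block_scale c x) \<subseteq> Poly_Mapping.keys x"
    by (auto simp: in_keys_iff)
  then show ?thesis
    by (simp add: block_bracket_superset[of "Poly_Mapping.keys x" "Poly_Mapping.keys y"]
        block.scale_sum_right case_prod_unfold mult.assoc)
qed

lemma block_bracket_scale_right: "block_bracket x (block_scale c y) = block_scale c (block_bracket x y)"
  using block_bracket_anticommute[of x]
  by (simp add: block_bracket_scale_left block.scale_minus_right)

lemma block_bracket_self: "block_bracket x x = 0"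
proof (rule poly_mapping_eqI)
  fix k
  show "Poly_Mapping.lookup (block_bracket x x) k = Poly_Mapping.lookup 0 k"
    using arg_cong[OF block_bracket_anticommute[of x x], of "\<lambda>z. Poly_Mapping.lookup z k"] by simp
qed

lemma block_induct [case_names zero single add]:
  assumes "P 0" "\<And>\<alpha> i a. P (Poly_Mapping.single (\<alpha>, i) a)" "\<And>x y. P x \<Longrightarrow> P y \<Longrightarrow> P (x + y)"
  shows "P (x :: block)"
proof -
  have "P (\<Sum>(\<alpha>, i)\<in>S. block_scale (Poly_Mapping.lookup x (\<alpha>, i)) (block_L \<alpha> i))" if "finite S" for S
    using that by induction (auto simp: block_scale_L intro: assms)
  then show ?thesis by (subst block_expansion) simp
qed

lemma block_jacobi:
  "block_bracket x (block_bracket y z) + block_bracket y (block_bracket z x) +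
     block_bracket z (block_bracket x y) = 0"
proof -
  define J where "J x y z = block_bracket x (block_bracket y z) + block_bracket y (block_bracket z x) +
     block_bracket z (block_bracket x y)" for x y z
  have add: "J (u + v) y z = J u y z + J v y z" for u v y z
    by (simp add: J_def block_bracket_add_left block_bracket_add_right)
  have zero: "J 0 y z = 0" for y z
    using add[of 0 0 y z] by simp
  have rot: "J x y z = J y z x" for x y z
    by (simp add: J_def)
  have add2: "J x (u + v) z = J x u z + J x v z" "J x 0 z = 0" for u v x z
    unfolding rot[of x] by (fact add zero)+
  have add3: "J x y (u + v) = J x y u + J x y v" "J x y 0 = 0" for u v x y
    unfolding rot[of x y] by (fact add2)+
  have single: "J (Poly_Mapping.single (\<alpha>, i) a) (Poly_Mapping.single (\<beta>, j) b)
      (Poly_Mapping.single (\<gamma>, k) c) = 0" for \<alpha> \<beta> \<gamma> i j k a b c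
  proof -
    have 1: "\<beta> + (\<gamma> + \<alpha>) = \<alpha> + (\<beta> + \<gamma>)" "\<gamma> + (\<alpha> + \<beta>) = \<alpha> + (\<beta> + \<gamma>)"
      "j + (k + i) = i + (j + k)" "k + (i + j) = i + (j + k)" by auto
    have single_zero_iff: "Poly_Mapping.single p d = 0 \<longleftrightarrow> d = 0" for p :: "int \<times> nat" and d :: complex
      by (metis lookup_single_eq lookup_zero single_zero)
    show ?thesis
      unfolding J_def block_bracket_single 1 single_add[symmetric] single_zero_iff
      by (simp add: algebra_simps)
  qed
  have 2: "J x (Poly_Mapping.single (\<beta>, j) b) (Poly_Mapping.single (\<gamma>, k) c) = 0" for x \<beta> j b \<gamma> k c
    by (induction x rule: block_induct) (simp_all add: add zero single)
  have 3: "J x y (Poly_Mapping.single (\<gamma>, k) c) = 0" for x y \<gamma> k c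
    by (induction y rule: block_induct) (simp_all add: add2 2)
  have "J x y z = 0"
    by (induction z rule: block_induct) (simp_all add: add3 3)
  then show ?thesis by (simp add: J_def)
qed

interpretation block: lie_algebra block_scale block_bracket
  by unfold_locales
     (fact block_bracket_add_left block_bracket_add_right block_bracket_scale_left
        block_bracket_scale_right block_bracket_self block_jacobi)+

end

theory Submission
  imports Defs
begin

text \<open>
  Identify \<open>L\<^bsub>\<alpha>,i\<^esub>\<close> with the monomial \<open>u\<^bsup>1-\<alpha>\<^esup> y\<^bsup>i+1\<^esup>\<close>. The bracket becomes the Poisson bracket
  \<open>[f, g] = (\<partial>f/\<partial>y) (\<partial>g/\<partial>u) - (\<partial>f/\<partial>u) (\<partial>g/\<partial>y)\<close> on the polynomials in \<open>u, 1/u, y\<close> that are divisible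
  by \<open>y\<close>. The proof rests on two facts.

  \<^item> Every derivation is an inner one plus a multiple of \<open>y \<partial>/\<partial>y - 1\<close>, which multiplies
    \<open>L\<^bsub>\<alpha>,i\<^esub>\<close> by \<open>i\<close> (\<open>derivation_classification\<close>). After subtracting an inner derivation, a
    derivation kills \<open>u y\<close> and \<open>y\<close>; commuting with \<open>ad (u y)\<close> it preserves the degree
    \<open>\<alpha> + i\<close>, and this together with \<open>ad y\<close> and \<open>ad (u\<^sup>2 y)\<close> leaves only one free scalar.

  \<^item> For \<open>M \<ge> 1\<close> put \<open>z\<^sub>M = L\<^bsub>1,M\<^esub> + L\<^bsub>0,M+1\<^esub> = y\<^bsup>M+1\<^esup> (1 + u y)\<close>. A derivation that kills \<open>z\<^sub>M\<close> is
    \<open>ad g\<close> where every basis vector occurring in \<open>g\<close> has degree at least \<open>M + 1\<close>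
    (\<open>derivation_killing_pair\<close>), so it raises all degrees by at least \<open>M + 1\<close>.

  Let \<open>\<Delta>\<close> be a 2-local derivation. Subtracting a derivation that agrees with \<open>\<Delta>\<close> at
  \<open>L\<^bsub>1,0\<^esub> = y\<close> and \<open>L\<^bsub>0,1\<^esub> = u y\<^sup>2\<close>, one may assume that \<open>\<Delta>\<close> vanishes at both. Then \<open>\<Delta> z\<^sub>M\<close> is the value
  at \<open>z\<^sub>M\<close> of a derivation killing \<open>y\<close> and also of one killing \<open>u y\<^sup>2\<close>; these two shapes are
  compatible only if \<open>\<Delta> z\<^sub>M = 0\<close> (\<open>agreeing_derivations_kill_pair\<close>). For an arbitrary \<open>x\<close>,
  comparing with \<open>z\<^sub>M\<close> shows that \<open>\<Delta> x = [g, x]\<close> with \<open>g\<close> of degree at least \<open>M + 1\<close>. As \<open>M\<close> is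
  arbitrary, \<open>\<Delta> x\<close> has components only in arbitrarily high degrees, hence \<open>\<Delta> x = 0\<close>.
\<close>

section \<open>Coordinates\<close>

text \<open>
  Coordinates with an integer second index, zero at the negative ones. The support of a bracket
  with a basis vector is a shifted support, and with integers the shift needs no case
  distinction on truncated subtraction.
\<close>

definition coord :: "block \<Rightarrow> int \<Rightarrow> int \<Rightarrow> complex" where
  "coord x a i = (if i < 0 then 0 else Poly_Mapping.lookup x (a, nat i))"

lemma coord_neg [simp]: "i < 0 \<Longrightarrow> coord x a i = 0"
  by (simp add: coord_def)

lemma coord_eqI: "(\<And>a i. i \<ge> 0 \<Longrightarrow> coord x a i = coord y a i) \<Longrightarrow> x = y"
proof (rule poly_mapping_eqI)
  fix k :: "int \<times> nat" assume *: "\<And>a i. i \<ge> 0 \<Longrightarrow> coord x a i = coord y a i"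
  show "Poly_Mapping.lookup x k = Poly_Mapping.lookup y k"
    using *[of "int (snd k)" "fst k"] by (simp add: coord_def)
qed

lemma coord_0 [simp]: "coord 0 a i = 0"
  by (simp add: coord_def)

lemma coord_add [simp]: "coord (x + y) a i = coord x a i + coord y a i"
  by (simp add: coord_def lookup_add)

lemma coord_uminus [simp]: "coord (- x) a i = - coord x a i"
  by (simp add: coord_def)

lemma coord_scale [simp]: "coord (block_scale c x) a i = c * coord x a i"
  by (simp add: coord_def)

lemma coord_single [simp]:
  "coord (Poly_Mapping.single (b, j) c) a i = (if a = b \<and> i = int j then c else 0)"
  by (auto simp: coord_def lookup_single when_def)

lemma coord_L [simp]: "coord (block_L b j) a i = (if a = b \<and> i = int j then 1 else 0)"
  by (simp add: block_L_def)

lemma finite_coord_support: "finite {(a, i). coord x a i \<noteq> 0}"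
proof -
  have "{(a, i). coord x a i \<noteq> 0} \<subseteq> (\<lambda>(a, n). (a, int n)) ` Poly_Mapping.keys x"
    by (force simp: coord_def in_keys_iff image_iff split: if_splits)
  then show ?thesis
    by (rule finite_subset) simp
qed

lemma coord_support_bounded: "\<exists>B::int. \<forall>a i. coord x a i \<noteq> 0 \<longrightarrow> \<bar>a\<bar> < B \<and> i < B"
proof -
  let ?S = "{(a, i). coord x a i \<noteq> 0}"
  have "\<bar>a\<bar> < (\<Sum>(a, i)\<in>?S. \<bar>a\<bar> + \<bar>i\<bar>) + 1 \<and> i < (\<Sum>(a, i)\<in>?S. \<bar>a\<bar> + \<bar>i\<bar>) + 1"
    if "coord x a i \<noteq> 0" for a i
    using that member_le_sum[of "(a, i)" ?S "\<lambda>(a, i). \<bar>a\<bar> + \<bar>i\<bar>"] finite_coord_support[of x]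
    by auto
  then show ?thesis
    by blast
qed

lemma block_of_coords:
  assumes "finite {(a, i). f a i \<noteq> 0}" and "\<And>a i. i < 0 \<Longrightarrow> f a i = 0"
  obtains x where "\<And>a i. coord x a i = f a i"
proof -
  let ?g = "\<lambda>p :: int \<times> nat. f (fst p) (int (snd p))"
  have "finite ((\<lambda>(a, n). (a, int n)) -` {(a, i). f a i \<noteq> 0})"
    by (rule finite_vimageI[OF assms(1)]) (auto simp: inj_def)
  moreover have "(\<lambda>(a, n). (a, int n)) -` {(a, i). f a i \<noteq> 0} = {p. ?g p \<noteq> 0}"
    by auto
  ultimately have "Poly_Mapping.lookup (Abs_poly_mapping ?g) = ?g"
    by (simp add: Abs_poly_mapping_inverse)
  then have "coord (Abs_poly_mapping ?g) a i = f a i" for a i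
    using assms(2)[of i a] by (auto simp: coord_def)
  then show ?thesis
    by (rule that)
qed

lemma block_bracket_0 [simp]: "block_bracket 0 x = 0" "block_bracket x 0 = 0"
  using block_bracket_add_left[of 0 0 x] block_bracket_add_right[of x 0 0] by simp_all

lemma block_bracket_minus_right: "block_bracket x (- y) = - block_bracket x y"
  using block_bracket_add_right[of x y "- y"] by (simp add: eq_neg_iff_add_eq_0 add.commute)

lemma block_bracket_diff:
  "block_bracket (x - x') y = block_bracket x y - block_bracket x' y"
  "block_bracket y (x - x') = block_bracket y x - block_bracket y x'"
  using block_bracket_add_left[of "x - x'" x' y] block_bracket_add_right[of y "x - x'" x']
  by (simp_all add: algebra_simps)

lemma coord_bracket_L_left:
  "coord (block_bracket (block_L b j) x) a i =
     of_int ((b - 1) * (i - int j + 1) - (a - b - 1) * (int j + 1)) * coord x (a - b) (i - int j)"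
proof (induction x rule: block_induct)
  case zero
  then show ?case
    by simp
next
  case (single \<alpha> k c)
  then show ?case
    by (auto simp: block_L_def block_bracket_single)
next
  case (add x y)
  then show ?case
    by (simp add: block_bracket_add_right distrib_left)
qed

lemma coord_bracket_L_right:
  "coord (block_bracket x (block_L b j)) a i =
     of_int ((a - b - 1) * (int j + 1) - (b - 1) * (i - int j + 1)) * coord x (a - b) (i - int j)"
  by (subst block_bracket_anticommute) (simp add: coord_bracket_L_left algebra_simps)

text \<open>The bracket is graded by both indices.\<close>

lemma coord_bracket_nonzeroE:
  assumes "coord (block_bracket x y) c k \<noteq> 0"
  obtains a i b j where "coord x a i \<noteq> 0" "coord y b j \<noteq> 0" "c = a + b" "k = i + j"
proof -
  have k: "k \<ge> 0"
    using assms by (meson coord_neg linorder_not_less)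
  have "(\<Sum>(a, i)\<in>Poly_Mapping.keys x. \<Sum>(b, j)\<in>Poly_Mapping.keys y.
      coord (block_scale (Poly_Mapping.lookup x (a, i) * Poly_Mapping.lookup y (b, j) *
             of_int ((a - 1) * (int j + 1) - (b - 1) * (int i + 1)))
          (block_L (a + b) (i + j))) c k) \<noteq> 0"
    using assms k by (simp add: coord_def block_bracket_def lookup_sum case_prod_unfold)
  then obtain a i where 1: "(a, i) \<in> Poly_Mapping.keys x" and
    "(\<Sum>(b, j)\<in>Poly_Mapping.keys y.
      coord (block_scale (Poly_Mapping.lookup x (a, i) * Poly_Mapping.lookup y (b, j) *
             of_int ((a - 1) * (int j + 1) - (b - 1) * (int i + 1)))
          (block_L (a + b) (i + j))) c k) \<noteq> 0"
    by (rule sum.not_neutral_contains_not_neutral) auto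
  from this(2) obtain b j where 2: "(b, j) \<in> Poly_Mapping.keys y" and
    "coord (block_scale (Poly_Mapping.lookup x (a, i) * Poly_Mapping.lookup y (b, j) *
             of_int ((a - 1) * (int j + 1) - (b - 1) * (int i + 1)))
          (block_L (a + b) (i + j))) c k \<noteq> 0"
    by (rule sum.not_neutral_contains_not_neutral) auto
  then have "c = a + b" "k = int i + int j"
    by (auto split: if_splits)
  with 1 2 show ?thesis
    by (intro that[of a "int i" b "int j"]) (auto simp: coord_def in_keys_iff)
qed

section \<open>Derivations\<close>

lemma block_derivation_iff:
  "block.derivation D \<longleftrightarrow>
     (\<forall>x y. D (x + y) = D x + D y) \<and> (\<forall>c x. D (block_scale c x) = block_scale c (D x)) \<and>
     (\<forall>x y. D (block_bracket x y) = block_bracket (D x) y + block_bracket x (D y))"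
proof -
  have "Vector_Spaces.linear block_scale block_scale D \<longleftrightarrow>
     (\<forall>x y. D (x + y) = D x + D y) \<and> (\<forall>c x. D (block_scale c x) = block_scale c (D x))"
    using block.vector_space_axioms by (auto simp: Vector_Spaces.linear_iff)
  then show ?thesis
    by (simp add: block.derivation_def)
qed

lemma
  assumes "block.derivation D"
  shows derivation_add: "D (x + y) = D x + D y"
    and derivation_scale: "D (block_scale c x) = block_scale c (D x)"
    and derivation_bracket: "D (block_bracket x y) = block_bracket (D x) y + block_bracket x (D y)"
  using assms by (auto simp: block_derivation_iff)

lemma derivation_0: "block.derivation D \<Longrightarrow> D 0 = 0"
  using derivation_add[of D 0 0] by simp

lemma derivation_uminus: "block.derivation D \<Longrightarrow> D (- x) = - D x"
  using derivation_add[of D x "- x"] derivation_0[of D]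
  by (simp add: eq_neg_iff_add_eq_0 add.commute)

lemma derivation_minus:
  assumes "block.derivation D" "block.derivation E"
  shows "block.derivation (\<lambda>x. D x - E x)"
  using assms
  by (auto simp: block_derivation_iff block.scale_right_diff_distrib block_bracket_diff)

lemma derivation_scale_fun:
  assumes "block.derivation D"
  shows "block.derivation (\<lambda>x. block_scale c (D x))"
  using assms
  by (auto simp: block_derivation_iff block.scale_right_distrib block_bracket_scale_left
      block_bracket_scale_right mult.commute)

lemma derivation_inner: "block.derivation (block_bracket g)"
proof -
  have "block_bracket g (block_bracket x y) =
      block_bracket (block_bracket g x) y + block_bracket x (block_bracket g y)" for x y
    using block_jacobi[of g x y]
    by (simp add: block_bracket_anticommute[of y "block_bracket g x"]
        block_bracket_anticommute[of y g] block_bracket_minus_right algebra_simps)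
  then show ?thesis
    by (simp add: block_derivation_iff block_bracket_add_right block_bracket_scale_right)
qed

text \<open>The outer derivation \<open>y \<partial>/\<partial>y - 1\<close>; the bracket lowers the total degree in \<open>y\<close> by one,
  so that the Euler operator becomes a derivation after subtracting the identity.\<close>

definition block_grading :: "block \<Rightarrow> block" where
  "block_grading = Poly_Mapping.mapp (\<lambda>(a, i) c. of_nat i * c)"

lemma coord_grading [simp]: "coord (block_grading x) a i = of_int i * coord x a i"
  by (auto simp: coord_def block_grading_def lookup_mapp when_def in_keys_iff)

lemma derivation_grading: "block.derivation block_grading"
proof -
  have add: "block_grading (x + y) = block_grading x + block_grading y" for x y
    by (rule coord_eqI) (simp add: algebra_simps)
  have zero: "block_grading 0 = 0"
    by (rule coord_eqI) simp
  have grading_single: "block_grading (Poly_Mapping.single (a, i) c) = Poly_Mapping.single (a, i) (of_nat i * c)"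
    for a i c
    by (rule coord_eqI) simp
  have 1: "block_grading (block_bracket (Poly_Mapping.single (a, i) c) y) =
      block_bracket (block_grading (Poly_Mapping.single (a, i) c)) y +
      block_bracket (Poly_Mapping.single (a, i) c) (block_grading y)" for a i c y
  proof (induction y rule: block_induct)
    case (single b j d)
    show ?case
      by (simp add: block_bracket_single grading_single
          single_add[symmetric] algebra_simps)
  qed (simp_all add: zero add block_bracket_add_right)
  have "block_grading (block_bracket x y) =
      block_bracket (block_grading x) y + block_bracket x (block_grading y)" for x y
    by (induction x rule: block_induct) (simp_all add: zero add block_bracket_add_left 1)
  moreover have "block_grading (block_scale c x) = block_scale c (block_grading x)" for c x
    by (rule coord_eqI) simp
  ultimately show ?thesis
    by (simp add: block_derivation_iff add)
qed

lemma derivation_eq_0I: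
  assumes D: "block.derivation D" and "\<And>a i. D (block_L a i) = 0"
  shows "D x = 0"
proof (induction x rule: block_induct)
  case (single a i c)
  then show ?case
    using assms by (simp add: block_scale_L[symmetric] derivation_scale)
qed (simp_all add: derivation_0[OF D] derivation_add[OF D])

lemma derivation_generate:
  assumes D: "block.derivation D" and "D (block_L a i) = 0" "D (block_L b j) = 0"
    and "(a - 1) * (int j + 1) \<noteq> (b - 1) * (int i + 1)"
  shows "D (block_L (a + b) (i + j)) = 0"
proof -
  have "block_scale (of_int ((a - 1) * (int j + 1) - (b - 1) * (int i + 1)))
      (D (block_L (a + b) (i + j))) = 0"
    using derivation_bracket[OF D, of "block_L a i" "block_L b j"] assms(2,3)
    by (simp only: block_bracket_L derivation_scale[OF D]) simp
  moreover have "complex_of_int ((a - 1) * (int j + 1) - (b - 1) * (int i + 1)) \<noteq> 0"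
    using assms(4) by (metis of_int_eq_0_iff eq_iff_diff_eq_0)
  ultimately show ?thesis
    using block.scale_eq_0_iff by blast
qed

lemma derivation_commutes_ad:
  assumes "block.derivation D" "D v = 0"
  shows "D (block_bracket v w) = block_bracket v (D w)"
  using derivation_bracket[OF assms(1), of v w] assms(2) by simp

text \<open>\<open>L\<^bsub>\<beta>,j\<^esub>\<close> is an eigenvector of \<open>ad L\<^bsub>0,0\<^esub>\<close> with eigenvalue \<open>- (\<beta> + j)\<close>, and a derivation killing
  \<open>L\<^bsub>0,0\<^esub>\<close> commutes with \<open>ad L\<^bsub>0,0\<^esub>\<close>.\<close>

lemma derivation_homogeneous:
  assumes D: "block.derivation D" and "D (block_L 0 0) = 0"
    and "coord (D (block_L b j)) a i \<noteq> 0"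
  shows "a + i = b + int j"
proof -
  have "of_int (a + i - (b + int j)) * coord (D (block_L b j)) a i = 0"
    using arg_cong[OF derivation_commutes_ad[OF assms(1,2)], of "\<lambda>x. coord x a i" "block_L b j"]
    by (simp only: block_bracket_L coord_bracket_L_left derivation_scale[OF D] coord_scale)
       (simp add: algebra_simps)
  then show ?thesis
    using assms(3) by (simp del: of_int_add of_int_diff)
qed

section \<open>Classification of the derivations\<close>

text \<open>The image of the diagonal operator \<open>ad L\<^bsub>0,0\<^esub>\<close> consists of the elements without a component of
  degree \<open>0\<close>. Such a component of \<open>D L\<^bsub>0,0\<^esub>\<close> is excluded by applying \<open>D\<close> to
  \<open>[L\<^bsub>0,0\<^esub>, L\<^bsub>1,0\<^esub>] = - L\<^bsub>1,0\<^esub>\<close> and comparing the components of degree \<open>1\<close>.\<close>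

lemma derivation_value_in_image_ad_L00:
  assumes D: "block.derivation D"
  obtains h where "D (block_L 0 0) = block_bracket h (block_L 0 0)"
proof -
  define v where "v = D (block_L 0 0)"
  have resonant: "coord v a i = 0" if "a + i = 0" "i \<ge> 0" for a i
  proof -
    have "block_scale (- 1) (D (block_L 1 0)) =
        block_bracket v (block_L 1 0) + block_bracket (block_L 0 0) (D (block_L 1 0))"
      using derivation_bracket[OF D, of "block_L 0 0" "block_L 1 0"]
      by (simp add: v_def block_bracket_L derivation_uminus[OF D])
    from arg_cong[OF this, of "\<lambda>x. coord x (a + 1) (- a)"]
    have "of_int a * coord v a (- a) = coord v a (- a)"
      by (simp add: coord_bracket_L_left coord_bracket_L_right algebra_simps)
    moreover have "i = - a" "a \<noteq> 1"
      using that by auto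
    ultimately show ?thesis
      by simp
  qed
  \<comment> \<open>In degree \<open>0\<close> the quotient is \<open>x / 0 = 0\<close>, a harmless choice because \<open>v\<close> vanishes there.\<close>
  obtain h where h: "\<And>a i. coord h a i = coord v a i / of_int (a + i)"
  proof (rule block_of_coords[of "\<lambda>a i. coord v a i / of_int (a + i)"])
    show "finite {(a, i). coord v a i / of_int (a + i) \<noteq> 0}"
      by (rule finite_subset[OF _ finite_coord_support[of v]]) auto
  qed auto
  have "v = block_bracket h (block_L 0 0)"
    by (rule coord_eqI) (auto simp: coord_bracket_L_right h resonant simp flip: of_int_add)
  then show ?thesis
    using that by (simp add: v_def)
qed

text \<open>Bracketing with \<open>L\<^bsub>1,0\<^esub> = y\<close> is, up to sign, differentiation with respect to \<open>u\<close>, whose image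
  misses exactly the multiples of \<open>1/u\<close>. The element \<open>D L\<^bsub>1,0\<^esub>\<close> has degree \<open>1\<close>, where no
  such monomial exists. A primitive of degree \<open>0\<close> can be taken, which commutes with \<open>L\<^bsub>0,0\<^esub>\<close>, so
  that subtracting its inner derivation preserves the value at \<open>L\<^bsub>0,0\<^esub>\<close>.\<close>

lemma derivation_value_in_image_ad_L10:
  assumes D: "block.derivation D" and "D (block_L 0 0) = 0"
  obtains q where "D (block_L 1 0) = block_bracket q (block_L 1 0)"
    and "block_bracket q (block_L 0 0) = 0"
proof -
  let ?v = "D (block_L 1 0)"
  have degree: "a + i = 1" if "coord ?v a i \<noteq> 0" for a i
    using derivation_homogeneous[OF assms that] by simp
  obtain q where q: "\<And>a i. coord q a i = coord ?v (a + 1) i / of_int (a - 1)"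
  proof (rule block_of_coords[of "\<lambda>a i. coord ?v (a + 1) i / of_int (a - 1)"])
    have "{(a, i). coord ?v (a + 1) i / of_int (a - 1) \<noteq> 0}
        \<subseteq> (\<lambda>(a, i). (a - 1, i)) ` {(a, i). coord ?v a i \<noteq> 0}"
      by (force simp: image_iff)
    then show "finite {(a, i). coord ?v (a + 1) i / of_int (a - 1) \<noteq> 0}"
      by (rule finite_subset) (intro finite_imageI finite_coord_support)
  qed auto
  have "?v = block_bracket q (block_L 1 0)"
  proof (rule coord_eqI)
    fix a i :: int assume "i \<ge> 0"
    then have "coord ?v 2 i = 0"
      using degree[of 2 i] by auto
    then show "coord ?v a i = coord (block_bracket q (block_L 1 0)) a i"
      by (cases "a = 2") (auto simp: coord_bracket_L_right q eq_divide_eq)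
  qed
  moreover have "block_bracket q (block_L 0 0) = 0"
  proof (rule coord_eqI)
    fix a i :: int
    show "coord (block_bracket q (block_L 0 0)) a i = coord 0 a i"
      using degree[of "a + 1" i] by (auto simp: coord_bracket_L_right q simp flip: of_int_add)
  qed
  ultimately show ?thesis
    by (rule that)
qed

text \<open>\<open>D L\<^bsub>a,j\<^esub>\<close> commutes with \<open>y\<close>, hence is a polynomial in \<open>y\<close> without constant term, all of whose
  monomials have degree at least \<open>1\<close>; but its degree is \<open>a + j\<close>.\<close>

lemma derivation_vanishes_via_L10:
  assumes D: "block.derivation D" and 0: "D (block_L 0 0) = 0" "D (block_L 1 0) = 0"
    and "D (block_L (a + 1) j) = 0" and "a + int j \<le> 0"
  shows "D (block_L a j) = 0"
proof (rule coord_eqI)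
  fix c i :: int assume "i \<ge> 0"
  have "block_bracket (block_L 1 0) (D (block_L a j)) = 0"
    using assms(4) by (simp add: derivation_commutes_ad[OF D 0(2), symmetric] block_bracket_L
        derivation_scale[OF D] add.commute)
  from arg_cong[OF this, of "\<lambda>x. coord x (c + 1) i"]
  have "c = 1 \<or> coord (D (block_L a j)) c i = 0"
    by (auto simp: coord_bracket_L_left)
  moreover have "c \<noteq> 1" if "coord (D (block_L a j)) c i \<noteq> 0"
    using derivation_homogeneous[OF D 0(1) that] \<open>i \<ge> 0\<close> assms(5) by auto
  ultimately show "coord (D (block_L a j)) c i = coord 0 c i"
    by auto
qed

text \<open>\<open>D L\<^bsub>a,j\<^esub>\<close> commutes with \<open>L\<^bsub>-1,0\<^esub> = u\<^sup>2 y\<close>, hence is a polynomial in \<open>u\<^sup>2 y\<close> without constant term, all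
  of whose monomials have negative degree; but its degree is \<open>a + j\<close>.\<close>

lemma derivation_vanishes_via_Lm10:
  assumes D: "block.derivation D" and 0: "D (block_L 0 0) = 0" "D (block_L (-1) 0) = 0"
    and "D (block_L (a - 1) j) = 0" and "a + int j \<ge> 0"
  shows "D (block_L a j) = 0"
proof (rule coord_eqI)
  fix c i :: int assume "i \<ge> 0"
  have "block_bracket (block_L (-1) 0) (D (block_L a j)) = 0"
    using assms(4) by (simp add: derivation_commutes_ad[OF D 0(2), symmetric] block_bracket_L
        derivation_scale[OF D])
  from arg_cong[OF this, of "\<lambda>x. coord x (c - 1) i"]
  have "of_int (c + 2 * i + 1) * coord (D (block_L a j)) c i = 0"
    by (simp add: coord_bracket_L_left algebra_simps neg_eq_iff_add_eq_0)
  then have "c + 2 * i + 1 = 0 \<or> coord (D (block_L a j)) c i = 0"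
    by (simp del: of_int_add of_int_mult)
  moreover have "c + 2 * i + 1 \<noteq> 0" if "coord (D (block_L a j)) c i \<noteq> 0"
    using derivation_homogeneous[OF D 0(1) that] \<open>i \<ge> 0\<close> assms(5) by auto
  ultimately show "coord (D (block_L a j)) c i = coord 0 c i"
    by auto
qed

lemma derivation_vanishes_on_Witt:
  assumes D: "block.derivation D" and 0: "D (block_L 0 0) = 0" "D (block_L 1 0) = 0"
  shows "D (block_L a 0) = 0"
proof -
  have neg: "D (block_L a 0) = 0" if "a \<le> 1" for a
    using that
  proof (induction a rule: int_le_induct)
    case (step a)
    then show ?case
      using derivation_vanishes_via_L10[OF D 0, of "a - 1" 0] by simp
  qed (fact 0)
  show ?thesis
  proof (cases "a \<le> 1")
    case False
    then have "1 \<le> a"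
      by simp
    then show ?thesis
    proof (induction a rule: int_ge_induct)
      case (step a)
      then show ?case
        using derivation_vanishes_via_Lm10[OF D 0(1) neg, of "a + 1" 0] by simp
    qed (fact 0)
  qed (fact neg)
qed

text \<open>Brackets of the elements \<open>L\<^bsub>\<alpha>,0\<^esub>\<close> with \<open>L\<^bsub>1,1\<^esub>\<close> give all \<open>L\<^bsub>\<alpha>,1\<^esub>\<close> with \<open>\<alpha> \<noteq> 2\<close>. The exceptional
  \<open>L\<^bsub>2,1\<^esub>\<close> is reached through its bracket with \<open>L\<^bsub>-1,0\<^esub>\<close>. After that, brackets with
  the \<open>L\<^bsub>\<alpha>,1\<^esub>\<close> raise the second index one at a time.\<close>

lemma derivation_vanishing_on_generators:
  assumes D: "block.derivation D"
    and 0: "D (block_L 0 0) = 0" "D (block_L 1 0) = 0" "D (block_L 1 1) = 0"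
  shows "D x = 0"
proof -
  note Witt = derivation_vanishes_on_Witt[OF D 0(1,2)]
  have level_1: "D (block_L a 1) = 0" for a
  proof (cases "a = 2")
    case True
    have "D (block_L 2 1) = 0"
      using derivation_vanishes_via_Lm10[OF D 0(1) Witt, of 2 1] 0(3) by simp
    then show ?thesis
      using True by simp
  next
    case False
    then show ?thesis
      using derivation_generate[OF D Witt 0(3), of "a - 1"] by simp
  qed
  have "D (block_L a i) = 0" for a i
  proof (induction i arbitrary: a)
    case 0
    show ?case by (rule Witt)
  next
    case (Suc i)
    show ?case
    proof (cases "a = 2")
      case True
      then show ?thesis
        using derivation_generate[OF D level_1 Suc.IH, of 2 0] by simp
    next
      case False
      then show ?thesis
        using derivation_generate[OF D level_1 Suc.IH, of 1 "a - 1"] by simp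
    qed
  qed
  then show ?thesis
    by (rule derivation_eq_0I[OF D])
qed

text \<open>
  Once \<open>L\<^bsub>0,0\<^esub>\<close> and \<open>L\<^bsub>1,0\<^esub>\<close> are killed, the value at \<open>L\<^bsub>1,1\<^esub> = y\<^sup>2\<close> commutes with \<open>y\<close> and has degree \<open>2\<close>,
  so it is a multiple of \<open>y\<^sup>2\<close>. This multiple is the coefficient of the outer derivation.
\<close>

theorem derivation_classification:
  assumes D: "block.derivation D"
  obtains g \<nu> where "\<And>x. D x = block_bracket g x + block_scale \<nu> (block_grading x)"
proof -
  obtain h where h: "D (block_L 0 0) = block_bracket h (block_L 0 0)"
    by (rule derivation_value_in_image_ad_L00[OF D])
  define E where "E x = D x - block_bracket h x" for x
  have E: "block.derivation E"
    unfolding E_def by (rule derivation_minus[OF D derivation_inner])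
  have E0: "E (block_L 0 0) = 0"
    by (simp add: E_def h)
  obtain q where q: "E (block_L 1 0) = block_bracket q (block_L 1 0)"
      "block_bracket q (block_L 0 0) = 0"
    by (rule derivation_value_in_image_ad_L10[OF E E0])
  define F where "F x = E x - block_bracket q x" for x
  have F: "block.derivation F"
    unfolding F_def by (rule derivation_minus[OF E derivation_inner])
  have F0: "F (block_L 0 0) = 0" "F (block_L 1 0) = 0"
    by (simp_all add: F_def E0 q)
  define \<nu> where "\<nu> = coord (F (block_L 1 1)) 1 1"
  have F11: "F (block_L 1 1) = block_scale \<nu> (block_L 1 1)"
  proof (rule coord_eqI)
    fix a i :: int
    have "block_bracket (block_L 1 0) (F (block_L 1 1)) = 0"
      by (simp add: derivation_commutes_ad[OF F F0(2), symmetric] block_bracket_L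
          derivation_0[OF F])
    from arg_cong[OF this, of "\<lambda>x. coord x (a + 1) i"]
    have "a = 1 \<or> coord (F (block_L 1 1)) a i = 0"
      by (auto simp: coord_bracket_L_left)
    moreover have "a + i = 2" if "coord (F (block_L 1 1)) a i \<noteq> 0"
      using derivation_homogeneous[OF F F0(1) that] by simp
    ultimately show "coord (F (block_L 1 1)) a i = coord (block_scale \<nu> (block_L 1 1)) a i"
      by (cases "coord (F (block_L 1 1)) a i = 0") (auto simp: \<nu>_def)
  qed
  have grading_L: "block_grading (block_L a i) = block_scale (of_nat i) (block_L a i)" for a i
    by (rule coord_eqI) auto
  have "F x - block_scale \<nu> (block_grading x) = 0" for x
    by (rule derivation_vanishing_on_generators[OF derivation_minus[OF F
            derivation_scale_fun[OF derivation_grading, of \<nu>]]])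
       (simp_all add: F0 F11 grading_L del: One_nat_def)
  then have "D x = block_bracket (h + q) x + block_scale \<nu> (block_grading x)" for x
    by (simp add: F_def E_def block_bracket_add_left algebra_simps)
  then show ?thesis
    by (rule that)
qed

section \<open>Two-local derivations\<close>

lemma coord_inner_plus_grading_pair:
  "coord (block_bracket g (block_L 1 M + block_L 0 (M + 1)) +
      block_scale \<nu> (block_grading (block_L 1 M + block_L 0 (M + 1)))) a i =
    of_int ((a - 2) * (int M + 1)) * coord g (a - 1) (i - int M) +
    of_int ((a - 1) * (int M + 2) + i - int M) * coord g a (i - int M - 1) +
    \<nu> * ((if a = 1 \<and> i = int M then of_nat M else 0) +
          (if a = 0 \<and> i = int M + 1 then of_nat M + 1 else 0))"
  by (simp add: block_bracket_add_right coord_bracket_L_right algebra_simps)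

text \<open>The outer derivation kills \<open>y\<close>, so \<open>g\<close> commutes with \<open>y\<close> and does not involve \<open>u\<close>.\<close>

lemma derivation_killing_L10:
  assumes "block_bracket g (block_L 1 0) + block_scale \<nu> (block_grading (block_L 1 0)) = 0"
    and "coord g a i \<noteq> 0"
  shows "a = 1"
  using arg_cong[OF assms(1), of "\<lambda>x. coord x (a + 1) i"] assms(2)
  by (auto simp: coord_bracket_L_right split: if_splits)

text \<open>The elements commuting with \<open>u y\<^sup>2\<close> are its polynomials, supported on \<open>2 a + i = 1\<close>. In addition a
  multiple of \<open>L\<^bsub>0,0\<^esub> = u y\<close> may occur, since \<open>[u y, u y\<^sup>2]\<close> is a multiple of \<open>u y\<^sup>2\<close>; it has to
  compensate the outer part exactly.\<close>

lemma derivation_killing_L01: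
  assumes "block_bracket g (block_L 0 1) + block_scale \<mu> (block_grading (block_L 0 1)) = 0"
  shows "coord g a i \<noteq> 0 \<Longrightarrow> 2 * a + i = 1 \<or> a = 0 \<and> i = 0" and "coord g 0 0 = \<mu>"
proof -
  have *: "of_int (2 * a + i - 1) * coord g a i + (if a = 0 \<and> i = 0 then \<mu> else 0) = 0" for a i
    using arg_cong[OF assms, of "\<lambda>x. coord x a (i + 1)"]
    by (cases "a = 0 \<and> i = 0") (auto simp: coord_bracket_L_right algebra_simps)
  show "coord g 0 0 = \<mu>"
    using *[of 0 0] by simp
  assume "coord g a i \<noteq> 0"
  moreover have "of_int (2 * a + i - 1) * coord g a i = 0" if "\<not> (a = 0 \<and> i = 0)"
    using *[of a i] that by (simp only: if_False add_0_right)
  ultimately have "2 * a + i - 1 = 0" if "\<not> (a = 0 \<and> i = 0)"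
    using that by (metis mult_eq_0_iff of_int_eq_0_iff)
  then show "2 * a + i = 1 \<or> a = 0 \<and> i = 0"
    by auto
qed

text \<open>Write \<open>D = ad g + \<nu> (y \<partial>/\<partial>y - 1)\<close> and \<open>E = ad h + \<mu> (y \<partial>/\<partial>y - 1)\<close>, where \<open>g\<close> depends on \<open>y\<close> only and
  \<open>h\<close> is \<open>\<mu> u y\<close> plus a polynomial in \<open>u y\<^sup>2\<close>. Compare both values, at \<open>z = y\<^bsup>M+1\<^esup> + u y\<^bsup>M+2\<^esup>\<close>, by powers
  of \<open>u\<close>. The value of \<open>D\<close> involves \<open>u\<^sup>0\<close> and \<open>u\<^sup>1\<close> only, the latter with coefficient
  \<open>\<nu> (M + 1) y\<^bsup>M+2\<^esup>\<close>. In the value of \<open>E\<close> the two contributions of \<open>\<mu>\<close> to \<open>u y\<^bsup>M+2\<^esup>\<close> cancel, so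
  \<open>\<nu> = 0\<close>. The coefficient of \<open>u y\<^bsup>M+3\<^esup>\<close> then removes the linear term of the polynomial in \<open>u y\<^sup>2\<close>,
  and with it everything but a multiple of \<open>y\<^bsup>M+1\<^esup>\<close> from the part of \<open>E z\<close> free of \<open>u\<close>. That
  multiple is absent from \<open>D z\<close> because \<open>\<nu> = 0\<close>.\<close>

lemma agreeing_derivations_kill_pair:
  assumes D: "block.derivation D" "D (block_L 1 0) = 0"
    and E: "block.derivation E" "E (block_L 0 1) = 0"
    and eq: "D (block_L 1 M + block_L 0 (M + 1)) = E (block_L 1 M + block_L 0 (M + 1))"
    and "M \<ge> 1"
  shows "E (block_L 1 M + block_L 0 (M + 1)) = 0"
proof -
  define z where "z = block_L 1 M + block_L 0 (M + 1)"
  obtain g \<nu> where g: "\<And>x. D x = block_bracket g x + block_scale \<nu> (block_grading x)"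
    using derivation_classification[OF D(1)] by blast
  obtain h \<mu> where h: "\<And>x. E x = block_bracket h x + block_scale \<mu> (block_grading x)"
    using derivation_classification[OF E(1)] by blast
  have g1: "coord g a i = 0" if "a \<noteq> 1" for a i
    using derivation_killing_L10[of g \<nu> a i] D(2) g that by auto
  have h1: "2 * a + i = 1 \<or> a = 0 \<and> i = 0" if "coord h a i \<noteq> 0" for a i
    using derivation_killing_L01(1)[of h \<mu> a i] E(2) h that by auto
  have h00: "coord h 0 0 = \<mu>"
    using derivation_killing_L01(2)[of h \<mu>] E(2) h by auto
  have h_pos: "coord h a i = 0" if "a > 0" for a i
    using h1[of a i] that by (cases "i < 0") auto
  have Dz: "coord (D z) a i = of_int ((a - 2) * (int M + 1)) * coord g (a - 1) (i - int M) +
    of_int ((a - 1) * (int M + 2) + i - int M) * coord g a (i - int M - 1) +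
    \<nu> * ((if a = 1 \<and> i = int M then of_nat M else 0) +
          (if a = 0 \<and> i = int M + 1 then of_nat M + 1 else 0))" for a i
    unfolding g z_def by (rule coord_inner_plus_grading_pair)
  have Ez: "coord (E z) a i = of_int ((a - 2) * (int M + 1)) * coord h (a - 1) (i - int M) +
    of_int ((a - 1) * (int M + 2) + i - int M) * coord h a (i - int M - 1) +
    \<mu> * ((if a = 1 \<and> i = int M then of_nat M else 0) +
          (if a = 0 \<and> i = int M + 1 then of_nat M + 1 else 0))" for a i
    unfolding h z_def by (rule coord_inner_plus_grading_pair)
  have eq': "coord (D z) a i = coord (E z) a i" for a i
    using eq by (simp add: z_def)
  have "coord h (-1) 1 = 0" "coord h (-1) 2 = 0"
    using h1[of "-1" 1] h1[of "-1" 2] by auto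
  have "(of_nat M + 1) * \<nu> = 0"
    using eq'[of 0 "int M + 1"] \<open>coord h (-1) 1 = 0\<close> by (simp add: Dz Ez g1 h00 algebra_simps)
  moreover have "of_nat M + 1 \<noteq> (0 :: complex)"
    by (metis of_nat_Suc of_nat_eq_0_iff add.commute nat.distinct(1))
  ultimately have \<nu>: "\<nu> = 0"
    by simp
  \<comment> \<open>\<open>M \<ge> 1\<close> matters here: \<open>[u y\<^sup>2, u y\<^bsup>M+2\<^esup>]\<close> is \<open>- M u y\<^bsup>M+3\<^esup>\<close>.\<close>
  have h01: "coord h 0 1 = 0"
    using eq'[of 0 "int M + 2"] \<open>coord h (-1) 2 = 0\<close> \<open>M \<ge> 1\<close> by (simp add: Dz Ez g1)
  show ?thesis
    unfolding z_def[symmetric]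
  proof (rule coord_eqI)
    fix a i :: int
    consider "a = 1" "i = int M" | "a = 1" "i \<noteq> int M" | "a \<noteq> 1" "a \<noteq> 2" | "a = 2" by blast
    then show "coord (E z) a i = coord 0 a i"
    proof cases
      case 1
      then show ?thesis
        by (subst eq'[symmetric]) (simp add: Dz g1 \<nu>)
    next
      case 2
      have "coord h 0 (i - int M) = 0"
        using h1[of 0 "i - int M"] h01 2 by (cases "i - int M = 1") auto
      then show ?thesis
        using 2 by (simp add: Ez h_pos)
    next
      case 3
      then show ?thesis
        by (subst eq'[symmetric]) (simp add: Dz g1 \<nu>)
    next
      case 4
      then show ?thesis
        by (simp add: Ez h_pos)
    qed
  qed
qed

text \<open>Within one degree \<open>e = a + i\<close>, the equation \<open>D z = 0\<close> is a two-term recursion for the coordinates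
  of \<open>g\<close>. Descending from beyond the support of \<open>g\<close>, all coordinates vanish as long as the
  coefficient of the lower one is nonzero, and it can only be zero if \<open>e\<close> is a positive multiple of
  \<open>M + 1\<close>. The outer part enters the recursion only in degree \<open>0\<close>, at the two lowest steps; these
  give two incompatible values of \<open>coord g 0 0\<close> unless \<open>\<nu> = 0\<close>.\<close>

lemma derivation_killing_pair:
  assumes D: "block.derivation D" "D (block_L 1 M + block_L 0 (M + 1)) = 0"
  obtains g where "\<And>x. D x = block_bracket g x"
    and "\<And>a i. coord g a i \<noteq> 0 \<Longrightarrow> a + i \<ge> int M + 1"
proof -
  obtain g \<nu> where g: "\<And>x. D x = block_bracket g x + block_scale \<nu> (block_grading x)"
    using derivation_classification[OF D(1)] by blast
  have rec: "of_int ((a - 2) * (int M + 1)) * coord g (a - 1) (k + 1) +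
    of_int ((a - 1) * (int M + 2) + k + 1) * coord g a k +
    \<nu> * ((if a = 1 \<and> k = -1 then of_nat M else 0) +
          (if a = 0 \<and> k = 0 then of_nat M + 1 else 0)) = 0" for a k
  proof -
    have shift: "k + int M + 1 - int M = k + 1" "k + 1 - 1 = k"
      "(a - 1) * (int M + 2) + (k + int M + 1) - int M = (a - 1) * (int M + 2) + k + 1"
      "k + int M + 1 = int M \<longleftrightarrow> k = -1" "k + int M + 1 = int M + 1 \<longleftrightarrow> k = 0"
      by auto
    show ?thesis
      using arg_cong[OF D(2), of "\<lambda>x. coord x a (k + int M + 1)"]
      unfolding g coord_inner_plus_grading_pair shift coord_0 .
  qed
  have coeff: "(a - 1) * (int M + 2) + k + 1 \<noteq> 0" if "a + k < int M + 1" "k \<ge> 0" for a k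
  proof
    assume *: "(a - 1) * (int M + 2) + k + 1 = 0"
    then have "a + k = (1 - a) * (int M + 1)"
      by (simp add: algebra_simps)
    moreover have "1 - a > 0"
    proof (rule ccontr)
      assume "\<not> 1 - a > 0"
      then have "(a - 1) * (int M + 2) \<ge> 0"
        by (intro mult_nonneg_nonneg) auto
      with * that show False
        by simp
    qed
    then have "1 * (int M + 1) \<le> (1 - a) * (int M + 1)"
      by (intro mult_right_mono) auto
    ultimately show False
      using that(1) by (metis mult_1 not_le)
  qed
  have descent_step: "coord g a k = 0"
    if "coord g (a - 1) (k + 1) = 0" "a + k < int M + 1" "k \<ge> 0" "\<nu> = 0 \<or> k \<ge> 1" for a k
    using rec[of a k] coeff[of a k] that by (auto simp del: of_int_diff of_int_add of_int_mult)
  obtain B where B: "\<And>a i. coord g a i \<noteq> 0 \<Longrightarrow> i < B"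
    using coord_support_bounded[of g] by blast
  have descend: "coord g (e - k) k = 0" if "e < int M + 1" "k \<ge> 0" "\<nu> = 0 \<or> k \<ge> 1" for e k
  proof (cases "k \<ge> B")
    case True
    then show ?thesis
      using B[of "e - k" k] by auto
  next
    case False
    then have "k \<le> B"
      by simp
    then show ?thesis
      using that(2,3)
    proof (induction k rule: int_le_induct)
      case base
      then show ?case
        using B[of "e - B" B] by auto
    next
      case (step k)
      then show ?case
        using that(1) descent_step[of "e - (k - 1)" "k - 1"] by auto
    qed
  qed
  have "coord g (-1) 1 = 0"
    using descend[of 0 1] by simp
  then have "(of_nat M + 1) * (coord g 0 0 - \<nu>) = 0"
    using rec[of 0 0] by (simp add: algebra_simps)
  moreover have "of_nat M + 1 \<noteq> (0 :: complex)"
    by (metis of_nat_Suc of_nat_eq_0_iff add.commute nat.distinct(1))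
  ultimately have "coord g 0 0 = \<nu>"
    by simp
  moreover have "(of_nat M + 1) * coord g 0 0 = \<nu> * of_nat M"
    using rec[of 1 "-1"] by (simp add: algebra_simps)
  ultimately have \<nu>: "\<nu> = 0"
    by (simp add: algebra_simps)
  show ?thesis
  proof (rule that)
    show "D x = block_bracket g x" for x
      by (simp add: g \<nu>)
    show "a + i \<ge> int M + 1" if "coord g a i \<noteq> 0" for a i
    proof (rule ccontr)
      assume "\<not> a + i \<ge> int M + 1"
      moreover have "i \<ge> 0"
        using that by (meson coord_neg linorder_not_less)
      ultimately show False
        using descend[of "a + i" i] that \<nu> by simp
    qed
  qed
qed

lemma two_local_vanishing:
  assumes \<Delta>: "block.two_local_derivation \<Delta>" and 0: "\<Delta> (block_L 1 0) = 0" "\<Delta> (block_L 0 1) = 0"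
  shows "\<Delta> x = 0"
proof -
  have local: "\<exists>D. block.derivation D \<and> \<Delta> u = D u \<and> \<Delta> v = D v" for u v
    using \<Delta> by (simp add: block.two_local_derivation_def)
  have pair: "\<Delta> (block_L 1 M + block_L 0 (M + 1)) = 0" if "M \<ge> 1" for M
  proof -
    let ?z = "block_L 1 M + block_L 0 (M + 1)"
    obtain D where D: "block.derivation D" "\<Delta> (block_L 1 0) = D (block_L 1 0)" "\<Delta> ?z = D ?z"
      using local by blast
    obtain E where E: "block.derivation E" "\<Delta> (block_L 0 1) = E (block_L 0 1)" "\<Delta> ?z = E ?z"
      using local by blast
    show ?thesis
      using agreeing_derivations_kill_pair[OF D(1) _ E(1), of M] D E 0 that by simp
  qed
  obtain B where B: "\<And>a i. coord x a i \<noteq> 0 \<Longrightarrow> \<bar>a\<bar> < B \<and> i < B"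
    using coord_support_bounded[of x] by blast
  obtain C where C: "\<And>a i. coord (\<Delta> x) a i \<noteq> 0 \<Longrightarrow> \<bar>a\<bar> < C \<and> i < C"
    using coord_support_bounded[of "\<Delta> x"] by blast
  \<comment> \<open>The degrees in \<open>x\<close> are greater than \<open>- B\<close> and those in \<open>\<Delta> x\<close> less than \<open>2 C\<close>; a shift by more
    than \<open>B + 2 C\<close> leaves no common degree.\<close>
  define M where "M = nat (\<bar>B\<bar> + 2 * \<bar>C\<bar> + 1)"
  obtain D where D: "block.derivation D" "\<Delta> x = D x"
      "\<Delta> (block_L 1 M + block_L 0 (M + 1)) = D (block_L 1 M + block_L 0 (M + 1))"
    using local by blast
  have "D (block_L 1 M + block_L 0 (M + 1)) = 0"
    using pair[of M] D(3) by (simp add: M_def)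
  then obtain g where g: "\<And>x. D x = block_bracket g x"
      "\<And>a i. coord g a i \<noteq> 0 \<Longrightarrow> a + i \<ge> int M + 1"
    using derivation_killing_pair[OF D(1)] by metis
  show ?thesis
  proof (rule coord_eqI, rule ccontr)
    fix c k :: int assume "coord (\<Delta> x) c k \<noteq> coord 0 c k"
    then have nz: "coord (\<Delta> x) c k \<noteq> 0"
      by simp
    then obtain a i b j where "coord g a i \<noteq> 0" and x: "coord x b j \<noteq> 0" "c = a + b" "k = i + j"
      using D(2) g(1) by (metis coord_bracket_nonzeroE)
    then have "a + i \<ge> int M + 1"
      by (intro g(2))
    moreover have "j \<ge> 0"
      using x(1) by (meson coord_neg linorder_not_less)
    ultimately show False
      using x B[OF x(1)] C[OF nz] by (auto simp: M_def)
  qed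
qed

theorem theorem3p6:
  fixes \<Delta> :: "block \<Rightarrow> block"
  assumes "block.two_local_derivation \<Delta>"
  shows "block.derivation \<Delta>"
proof -
  obtain D where D: "block.derivation D" "\<Delta> (block_L 1 0) = D (block_L 1 0)"
      "\<Delta> (block_L 0 1) = D (block_L 0 1)"
    using assms by (auto simp: block.two_local_derivation_def)
  have "block.two_local_derivation (\<lambda>x. \<Delta> x - D x)"
    unfolding block.two_local_derivation_def
  proof (intro allI)
    fix x y
    obtain E where "block.derivation E" "\<Delta> x = E x" "\<Delta> y = E y"
      using assms by (auto simp: block.two_local_derivation_def)
    then show "\<exists>F. block.derivation F \<and> \<Delta> x - D x = F x \<and> \<Delta> y - D y = F y"
      using derivation_minus[OF _ D(1), of E] by auto
  qed
  then have "\<Delta> x - D x = 0" for x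
    by (rule two_local_vanishing) (simp_all add: D del: One_nat_def)
  then have "\<Delta> = D"
    by auto
  with D(1) show ?thesis
    by simp
qed

end
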